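(* Let $A\in\mathbf{R}^{n\times n}$ be a stable matrix, let $V=\{b_1,\dots,b_M\}$ be a finite set of possible input matrix columns $b_i\in\mathbf{R}^n$, let $B_0$ be a (possibly empty) existing input matrix with $n$ rows, and for each $S\subseteq V$ let $W_S$ be the infinite-horizon controllability Gramian associated with $S$. For any weighting matrix $C\in\mathbf{R}^{p\times n}$, the set function $f:2^V\to\mathbf{R}$ defined by $$f(S)=\mathrm{tr}(C W_S C^T)$$ is modular.
   Context: A matrix $A$ is stable if all its eigenvalues have strictly negative real part (so $\dot x=Ax$ is asymptotically stable). For $S\subseteq V$, $B_S=[B_0\ \ b_s]_{s\in S}$ is the matrix formed by the columns of the fixed (possibly empty) matrix $B_0$ together with the columns in $S$. The infinite-horizon controllability Gramian associated with $S$ is $W_S=\int_0^\infty e^{A\tau}B_SB_S^Te^{A^T\tau}\,d\tau\in\mathbf{R}^{n\times n}$, which is the unique positive semidefinite solution of the Lyapunov equation $AW_S+W_SA^T+B_SB_S^T=0$. A set function $f:2^V\to\mathbf{R}$ is submodular if $f(X)+f(Y)\ge f(X\cup Y)+f(X\cap Y)$ for all $X,Y\subseteq V$, supermodular if the reverse inequality holds for all $X,Y\subseteq V$, and modular if it is both, i.e. $f(X)+f(Y)=f(X\cup Y)+f(X\cap Y)$ for all $X,Y\subseteq V$. *)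

theory Defs
  imports
    "HOL-Analysis.Henstock_Kurzweil_Integration"
    "Jordan_Normal_Form.Char_Poly"
begin

definition stable_mat :: "real mat \<Rightarrow> bool" where
  "stable_mat A \<longleftrightarrow>
     (\<forall>z. eigenvalue (map_mat complex_of_real A) z \<longrightarrow> Re z < 0)"

definition mat_trace :: "'a :: comm_monoid_add mat \<Rightarrow> 'a" where
  "mat_trace M = (\<Sum>i<dim_row M. M $$ (i, i))"

text \<open>The exponential series, summed entry by entry.\<close>

definition mat_exp :: "real mat \<Rightarrow> real mat" where
  "mat_exp M = mat (dim_row M) (dim_row M)
     (\<lambda>(i, j). \<Sum>k. (M ^\<^sub>m k) $$ (i, j) / fact k)"

text \<open>
  The matrix whose columns are those of \<open>B0\<close> (which may have no columns) followed by the
  elements of the finite set \<open>S\<close>. These are listed in an arbitrary order; the order does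
  not affect the product of the matrix with its transpose, and the matrix is used only
  through that product.
\<close>

definition input_mat :: "real mat \<Rightarrow> real vec set \<Rightarrow> real mat" where
  "input_mat B0 S =
     mat_of_cols (dim_row B0) (cols B0 @ (SOME bs. distinct bs \<and> set bs = S))"

text \<open>The integral of a matrix-valued function is taken entry by entry.\<close>

definition gramian :: "real mat \<Rightarrow> real mat \<Rightarrow> real vec set \<Rightarrow> real mat" where
  "gramian A B0 S = mat (dim_row A) (dim_row A)
     (\<lambda>(i, j). integral {0..} (\<lambda>\<tau>.
        (mat_exp (\<tau> \<cdot>\<^sub>m A) * input_mat B0 S * transpose_mat (input_mat B0 S)
          * mat_exp (\<tau> \<cdot>\<^sub>m transpose_mat A)) $$ (i, j)))"

definition submodular_on :: "'a set \<Rightarrow> ('a set \<Rightarrow> real) \<Rightarrow> bool" where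
  "submodular_on V f \<longleftrightarrow>
     (\<forall>X Y. X \<subseteq> V \<and> Y \<subseteq> V \<longrightarrow> f X + f Y \<ge> f (X \<union> Y) + f (X \<inter> Y))"

definition supermodular_on :: "'a set \<Rightarrow> ('a set \<Rightarrow> real) \<Rightarrow> bool" where
  "supermodular_on V f \<longleftrightarrow>
     (\<forall>X Y. X \<subseteq> V \<and> Y \<subseteq> V \<longrightarrow> f X + f Y \<le> f (X \<union> Y) + f (X \<inter> Y))"

definition modular_on :: "'a set \<Rightarrow> ('a set \<Rightarrow> real) \<Rightarrow> bool" where
  "modular_on V f \<longleftrightarrow> submodular_on V f \<and> supermodular_on V f"

end

(* B_S B_S^T is a constant plus the sum of s s^T over s in S, so f is modular provided the integral
   may be split over these summands, i.e. provided each product of two entries of e^(tA) is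
   integrable on the half-line. After a Schur triangularization A = P B P^-1 the matrix
   P^-1 e^(tA) solves Y' = B Y, and back substitution through the triangular system shows that
   it decays exponentially, because the diagonal of B consists of eigenvalues of A. *)
theory Submission
  imports
    "HOL-Analysis.Equivalence_Lebesgue_Henstock_Integration"
    "Jordan_Normal_Form.Schur_Decomposition"
    Defs
begin

unbundle no vec_syntax

section \<open>The matrix exponential\<close>

lemma index_mult_mat_sum:
  assumes "A \<in> carrier_mat n m" "B \<in> carrier_mat m p" "i < n" "j < p"
  shows "(A * B) $$ (i, j) = (\<Sum>k<m. A $$ (i, k) * B $$ (k, j))"
  using assms by (simp add: scalar_prod_def lessThan_atLeast0)

lemma index_mult_mat_sum3:
  assumes "A \<in> carrier_mat n m" "B \<in> carrier_mat m p" "C \<in> carrier_mat p q" "i < n" "j < q"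
  shows "(A * B * C) $$ (i, j) = (\<Sum>l<p. \<Sum>k<m. A $$ (i, k) * B $$ (k, l) * C $$ (l, j))"
  using assms
  by (subst index_mult_mat_sum[of _ n p _ q], auto simp: index_mult_mat_sum[of _ n m _ p] sum_distrib_right
      simp del: index_mult_mat(1))

text \<open>\<open>pow_mat\<close> unfolds with the new factor on the right, while transposition and
  the equation X' = A X need it on the left.\<close>

lemma pow_mat_Suc_left:
  assumes "A \<in> carrier_mat n n"
  shows "A ^\<^sub>m Suc k = A * A ^\<^sub>m k"
proof (induction k)
  case 0
  show ?case using assms by auto
next
  case (Suc k)
  have "A ^\<^sub>m Suc (Suc k) = (A * A ^\<^sub>m k) * A" using Suc by simp
  also have "\<dots> = A * (A ^\<^sub>m k * A)"
    by (rule assoc_mult_mat[of _ n n _ n _ n]) (use assms in auto)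
  finally show ?case by simp
qed

lemma transpose_pow_mat:
  fixes A :: "'a :: comm_semiring_1 mat"
  assumes "A \<in> carrier_mat n n"
  shows "transpose_mat A ^\<^sub>m k = transpose_mat (A ^\<^sub>m k)"
proof (induction k)
  case 0
  show ?case using assms by simp
next
  case (Suc k)
  have "transpose_mat A ^\<^sub>m Suc k = transpose_mat (A ^\<^sub>m k) * transpose_mat A"
    using Suc by simp
  also have "\<dots> = transpose_mat (A * A ^\<^sub>m k)"
    by (rule transpose_mult[symmetric, of _ n n _ n]) (use assms in auto)
  finally show ?case using pow_mat_Suc_left[OF assms] by simp
qed

lemma smult_pow_mat:
  fixes A :: "'a :: comm_semiring_1 mat"
  assumes "A \<in> carrier_mat n n"
  shows "(t \<cdot>\<^sub>m A) ^\<^sub>m k = t ^ k \<cdot>\<^sub>m (A ^\<^sub>m k)"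
proof (induction k)
  case 0
  show ?case using assms by auto
next
  case (Suc k)
  have P: "A ^\<^sub>m k \<in> carrier_mat n n" using assms by simp
  show ?case using assms P
    by (intro eq_matI)
      (auto simp: Suc index_mult_mat_sum[of _ n n _ n] sum_distrib_left mult_ac
        simp del: index_mult_mat(1))
qed

text \<open>Geometric growth in \<open>k\<close> is slow enough for the factorials to make the
  exponential series converge at every \<open>t\<close>.\<close>

lemma pow_mat_entry_bound:
  fixes A :: "real mat"
  assumes "A \<in> carrier_mat n n"
  obtains c where "c \<ge> 0"
    and "\<And>k i j. i < n \<Longrightarrow> j < n \<Longrightarrow> \<bar>(A ^\<^sub>m k) $$ (i, j)\<bar> \<le> c ^ k"
proof
  \<comment> \<open>The sum of all absolute entries is a crude constant that dominates every column
    sum at once.\<close>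
  define c where "c = (\<Sum>j<n. \<Sum>l<n. \<bar>A $$ (l, j)\<bar>)"
  show c0: "c \<ge> 0" unfolding c_def by (intro sum_nonneg) auto
  have col: "(\<Sum>l<n. \<bar>A $$ (l, j)\<bar>) \<le> c" if "j < n" for j
    unfolding c_def using that
    by (intro member_le_sum[of j _ "\<lambda>j. \<Sum>l<n. \<bar>A $$ (l, j)\<bar>"]) (auto intro: sum_nonneg)
  show "\<bar>(A ^\<^sub>m k) $$ (i, j)\<bar> \<le> c ^ k" if "i < n" "j < n" for k i j
    using that
  proof (induction k arbitrary: j)
    case 0
    then show ?case using assms by auto
  next
    case (Suc k)
    have "\<bar>(A ^\<^sub>m Suc k) $$ (i, j)\<bar> = \<bar>\<Sum>l<n. (A ^\<^sub>m k) $$ (i, l) * A $$ (l, j)\<bar>"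
      using assms Suc.prems
      by (simp add: index_mult_mat_sum[of _ n n _ n] del: index_mult_mat(1))
    also have "\<dots> \<le> (\<Sum>l<n. \<bar>(A ^\<^sub>m k) $$ (i, l)\<bar> * \<bar>A $$ (l, j)\<bar>)"
      by (rule order_trans[OF sum_abs]) (simp add: abs_mult)
    also have "\<dots> \<le> (\<Sum>l<n. c ^ k * \<bar>A $$ (l, j)\<bar>)"
      using Suc by (intro sum_mono mult_right_mono) auto
    also have "\<dots> = c ^ k * (\<Sum>l<n. \<bar>A $$ (l, j)\<bar>)" by (simp add: sum_distrib_left)
    also have "\<dots> \<le> c ^ k * c" using col[OF Suc.prems(2)] c0 by (intro mult_left_mono) auto
    finally show ?case by (simp add: mult.commute del: pow_mat.simps)
  qed
qed

section \<open>Power series and derivative of the entries of e^(tA)\<close>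

lemma summable_mat_exp_entry:
  fixes A :: "real mat"
  assumes "A \<in> carrier_mat n n" "i < n" "j < n"
  shows "summable (\<lambda>k. (A ^\<^sub>m k) $$ (i, j) / fact k * t ^ k)"
proof -
  obtain c where c: "c \<ge> 0"
    "\<And>k i j. i < n \<Longrightarrow> j < n \<Longrightarrow> \<bar>(A ^\<^sub>m k) $$ (i, j)\<bar> \<le> c ^ k"
    using pow_mat_entry_bound[OF assms(1)] by blast
  show ?thesis
  proof (rule summable_comparison_test')
    show "summable (\<lambda>k. inverse (fact k) * (c * \<bar>t\<bar>) ^ k)" by (rule summable_exp)
    show "norm ((A ^\<^sub>m k) $$ (i, j) / fact k * t ^ k) \<le> inverse (fact k) * (c * \<bar>t\<bar>) ^ k" for k
      using mult_right_mono[OF c(2)[OF assms(2,3), of k], of "\<bar>t\<bar> ^ k / fact k"]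
      by (simp add: abs_mult power_abs power_mult_distrib divide_simps mult_ac)
  qed
qed

text \<open>The coefficients are kept free of \<open>t\<close>, so that each entry is a scalar power
  series open to termwise differentiation.\<close>

lemma mat_exp_smult_entry:
  assumes "A \<in> carrier_mat n n" "i < n" "j < n"
  shows "mat_exp (t \<cdot>\<^sub>m A) $$ (i, j) = (\<Sum>k. (A ^\<^sub>m k) $$ (i, j) / fact k * t ^ k)"
  using assms by (simp add: mat_exp_def smult_pow_mat[OF assms(1)] mult_ac)

lemma mat_exp_carrier [simp]:
  "A \<in> carrier_mat n n \<Longrightarrow> mat_exp A \<in> carrier_mat n n"
  by (simp add: mat_exp_def)

lemma mat_exp_transpose:
  assumes "A \<in> carrier_mat n n"
  shows "mat_exp (transpose_mat A) = transpose_mat (mat_exp A)"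
  using assms by (intro eq_matI) (auto simp: mat_exp_def transpose_pow_mat[OF assms])

text \<open>This is X' = A X for X = e^(tA), read entrywise. The shift in \<open>diffs\<close>
  cancels one factor of the factorial, and A^(k+1) = A A^k brings A out on the left.\<close>

lemma mat_exp_has_derivative:
  assumes A: "A \<in> carrier_mat n n" and i: "i < n" and j: "j < n"
  shows "((\<lambda>t. mat_exp (t \<cdot>\<^sub>m A) $$ (i, j)) has_field_derivative
           (\<Sum>l<n. A $$ (i, l) * mat_exp (t \<cdot>\<^sub>m A) $$ (l, j))) (at t)"
proof -
  have d: "diffs (\<lambda>k. (A ^\<^sub>m k) $$ (i, j) / fact k) k * t ^ k
      = (\<Sum>l<n. A $$ (i, l) * ((A ^\<^sub>m k) $$ (l, j) / fact k * t ^ k))" for k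
  proof -
    have "(A ^\<^sub>m Suc k) $$ (i, j) = (\<Sum>l<n. A $$ (i, l) * (A ^\<^sub>m k) $$ (l, j))"
      unfolding pow_mat_Suc_left[OF A] by (rule index_mult_mat_sum) (use assms in auto)
    moreover have "diffs (\<lambda>k. (A ^\<^sub>m k) $$ (i, j) / fact k) k = (A ^\<^sub>m Suc k) $$ (i, j) / fact k"
      by (simp add: diffs_def del: pow_mat.simps)
    ultimately show ?thesis
      by (simp add: sum_divide_distrib sum_distrib_right mult.assoc del: pow_mat.simps)
  qed
  have "(\<Sum>k. diffs (\<lambda>k. (A ^\<^sub>m k) $$ (i, j) / fact k) k * t ^ k)
      = (\<Sum>l<n. \<Sum>k. A $$ (i, l) * ((A ^\<^sub>m k) $$ (l, j) / fact k * t ^ k))"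
    unfolding d
    by (rule suminf_sum) (intro summable_mult summable_mat_exp_entry[OF A _ j], simp)
  also have "\<dots> = (\<Sum>l<n. A $$ (i, l) * mat_exp (t \<cdot>\<^sub>m A) $$ (l, j))"
    by (intro sum.cong refl)
      (simp only: mat_exp_smult_entry[OF A _ j] suminf_mult summable_mat_exp_entry[OF A _ j] lessThan_iff)
  finally show ?thesis
    using termdiffs_strong_converges_everywhere[OF summable_mat_exp_entry[OF A i j], of t]
    by (simp add: mat_exp_smult_entry[OF A i j])
qed

section \<open>Exponential decay\<close>

text \<open>Variation of constants: the norm of the derivative of \<open>exp (- l * t) * y t\<close> is integrated.\<close>

lemma exponential_decay_scalar_ode:
  fixes y g :: "real \<Rightarrow> complex"
  assumes y: "\<And>t. (y has_vector_derivative l * y t + g t) (at t)"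
    and g: "\<And>t. t \<ge> 0 \<Longrightarrow> norm (g t) \<le> K * exp (- d * t)"
    and d: "d < - Re l"
  obtains K' where "\<And>t. t \<ge> 0 \<Longrightarrow> norm (y t) \<le> K' * exp (- d * t)"
proof -
  \<comment> \<open>The surplus of the homogeneous decay rate over \<open>d\<close>. Once multiplied
    by the integrating factor, the forcing is at most \<open>K * exp (m * t)\<close>, which has
    antiderivative \<open>K / m * exp (m * t)\<close>.\<close>
  define m where "m = - Re l - d"
  have m: "m > 0" using d by (simp add: m_def)
  have K: "K \<ge> 0" using g[of 0] by (simp add: order_trans[OF norm_ge_zero])
  \<comment> \<open>The integrating factor cancels the term \<open>l * y t\<close>, leaving only the
    forcing in the derivative.\<close>
  define z where "z t = exp (- of_real t * l) * y t" for t
  have z': "(z has_vector_derivative exp (- of_real t * l) * g t) (at t)" for t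
  proof -
    have "((\<lambda>t. exp (- of_real t * l)) has_vector_derivative - l * exp (- of_real t * l)) (at t)"
      by (rule has_vector_derivative_real_field)
        (auto intro!: derivative_eq_intros simp: mult_ac)
    from has_vector_derivative_mult[OF this y[of t]] show ?thesis
      unfolding z_def by (simp add: algebra_simps)
  qed
  have bound: "norm (y t) \<le> (norm (y 0) + K / m) * exp (- d * t)" if t: "t \<ge> 0" for t
  proof -
    have "norm (z t - z 0) \<le> K / m * exp (m * t) - K / m * exp (m * 0)"
    \<comment> \<open>The mean value bound used below needs an interval of positive length.\<close>
    proof (cases "t = 0")
      case False
      show ?thesis
      proof (rule differentiable_bound_general)
        show "0 < t" using t False by simp
        show "continuous_on {0..t} z"
          using z' by (auto intro!: continuous_at_imp_continuous_on has_vector_derivative_continuous)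
        show "continuous_on {0..t} (\<lambda>t. K / m * exp (m * t))" by (intro continuous_intros)
        show "(z has_vector_derivative exp (- of_real s * l) * g s) (at s)" for s by (rule z')
        show "((\<lambda>t. K / m * exp (m * t)) has_vector_derivative K * exp (m * s)) (at s)" for s
          using m by (auto intro!: derivative_eq_intros
              simp: has_real_derivative_iff_has_vector_derivative[symmetric])
        show "norm (exp (- of_real s * l) * g s) \<le> K * exp (m * s)" if "0 < s" for s
        proof -
          have "norm (exp (- of_real s * l) * g s) \<le> exp (- (s * Re l)) * (K * exp (- d * s))"
            using g[of s] that by (simp add: norm_mult)
          also have "\<dots> = K * exp (m * s)"
            by (simp add: m_def mult.left_commute exp_add[symmetric] algebra_simps)
          finally show ?thesis .
        qed
      qed
    qed simp
    also have "\<dots> \<le> K / m * exp (m * t)" using K m by simp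
    finally have "norm (z t) \<le> norm (z 0) + K / m * exp (m * t)"
      using norm_triangle_ineq2[of "z t" "z 0"] by linarith
    \<comment> \<open>As \<open>m\<close> and \<open>t\<close> are nonnegative,
      \<open>exp (m * t)\<close> is at least 1 and absorbs the initial value.\<close>
    also have "\<dots> \<le> norm (y 0) * exp (m * t) + K / m * exp (m * t)"
      using m t by (simp add: z_def mult_le_cancel_left1)
    finally have *: "exp (- (t * Re l)) * norm (y t) \<le> (norm (y 0) + K / m) * exp (m * t)"
      by (simp add: z_def norm_mult algebra_simps)
    \<comment> \<open>Undoing the integrating factor turns the exponent \<open>m\<close> into
      \<open>m + Re l = - d\<close>.\<close>
    have "norm (y t) = exp (t * Re l) * (exp (- (t * Re l)) * norm (y t))"
      by (simp add: mult.assoc[symmetric] exp_add[symmetric])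
    also have "\<dots> \<le> exp (t * Re l) * ((norm (y 0) + K / m) * exp (m * t))"
      using * by (intro mult_left_mono) auto
    also have "\<dots> = (norm (y 0) + K / m) * exp (- d * t)"
      by (simp add: mult.left_commute[of "exp _"] exp_add[symmetric] m_def algebra_simps)
    finally show ?thesis .
  qed
  then show ?thesis using that by blast
qed

text \<open>Back substitution: row \<open>n - Suc k\<close> is a scalar equation forced by the rows below it.\<close>

lemma exponential_decay_triangular:
  fixes B :: "complex mat" and y :: "nat \<Rightarrow> real \<Rightarrow> complex"
  assumes B: "B \<in> carrier_mat n n" "upper_triangular B"
    and y: "\<And>i t. i < n \<Longrightarrow> (y i has_vector_derivative (\<Sum>l<n. B $$ (i, l) * y l t)) (at t)"
    and d: "\<And>i. i < n \<Longrightarrow> d < - Re (B $$ (i, i))"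
    and i: "i < n"
  shows "\<exists>K. \<forall>t\<ge>0. norm (y i t) \<le> K * exp (- d * t)"
  using i
proof (induction "n - i" arbitrary: i rule: less_induct)
  case less
  have "\<exists>K. \<forall>t\<ge>0. norm (y l t) \<le> K * exp (- d * t)" if "l \<in> {i<..<n}" for l
    using less that by (intro less.hyps) auto
  then obtain K where K: "\<And>l t. l \<in> {i<..<n} \<Longrightarrow> t \<ge> 0 \<Longrightarrow> norm (y l t) \<le> K l * exp (- d * t)"
    by metis
  define g where "g t = (\<Sum>l\<in>{i<..<n}. B $$ (i, l) * y l t)" for t
  have split: "(\<Sum>l<n. B $$ (i, l) * y l t) = B $$ (i, i) * y i t + g t" for t
  proof -
    \<comment> \<open>Upper triangularity removes the columns to the left of the diagonal.\<close>
    have "(\<Sum>l<n. B $$ (i, l) * y l t) = (\<Sum>l\<in>insert i {i<..<n}. B $$ (i, l) * y l t)"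
      using B less.prems by (intro sum.mono_neutral_right) (auto simp: upper_triangular_def)
    then show ?thesis by (simp add: g_def)
  qed
  \<comment> \<open>The forcing decays at the same rate \<open>d\<close> as the rows below. Because
    \<open>d\<close> is strictly less than \<open>- Re\<close> of every diagonal entry, no rate is
    lost from row to row, even for repeated eigenvalues.\<close>
  have g: "norm (g t) \<le> (\<Sum>l\<in>{i<..<n}. norm (B $$ (i, l)) * K l) * exp (- d * t)" if "t \<ge> 0" for t
    unfolding g_def sum_distrib_right
    by (rule sum_norm_le) (use K that in \<open>auto simp: norm_mult mult.assoc intro!: mult_left_mono\<close>)
  show ?case
    by (rule exponential_decay_scalar_ode[OF y[OF less.prems, unfolded split] g d[OF less.prems]]) auto
qed

text \<open>A single rate \<open>d\<close> serves all entries, and only the constant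
  \<open>K\<close> varies. The passage to complex matrices makes the characteristic polynomial
  split, as the Schur decomposition requires.\<close>

lemma mat_exp_exponential_decay:
  assumes A: "A \<in> carrier_mat n n" and stable: "stable_mat A"
  obtains d where "d > 0"
    and "\<And>i j. i < n \<Longrightarrow> j < n \<Longrightarrow>
      \<exists>K. \<forall>t\<ge>0. \<bar>mat_exp (t \<cdot>\<^sub>m A) $$ (i, j)\<bar> \<le> K * exp (- d * t)"
proof -
  let ?A = "map_mat complex_of_real A"
  let ?X = "\<lambda>i j t. complex_of_real (mat_exp (t \<cdot>\<^sub>m A) $$ (i, j))"
  have cA: "?A \<in> carrier_mat n n" using A by simp
  obtain es where es: "char_poly ?A = (\<Prod>a\<leftarrow>es. [:- a, 1:])"
    using char_poly_factorized[OF cA] by blast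
  obtain B P Q where "schur_decomposition ?A es = (B, P, Q)"
    by (cases "schur_decomposition ?A es")
  from schur_decomposition[OF cA es this] have sim: "similar_mat_wit ?A B P Q"
    and ut: "upper_triangular B" and diag: "diag_mat B = es" by auto
  note w = similar_mat_witD2[OF cA sim]
  \<comment> \<open>The diagonal of \<open>B\<close> lists the roots of the characteristic
    polynomial, so stability applies to each diagonal entry.\<close>
  have neg: "Re (B $$ (i, i)) < 0" if "i < n" for i
  proof -
    have "B $$ (i, i) \<in> set es" using that w(5) unfolding diag[symmetric] diag_mat_def by auto
    then have "poly (char_poly ?A) (B $$ (i, i)) = 0"
      unfolding es by (auto simp: poly_prod_list prod_list_zero_iff o_def)
    then show ?thesis using stable eigenvalue_root_char_poly[OF cA] by (auto simp: stable_mat_def)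
  qed
  \<comment> \<open>The element 1 keeps the set nonempty when \<open>n = 0\<close>. Half of this
    minimum serves as the rate, since back substitution asks for a strict gap.\<close>
  define m where "m = Min (insert 1 ((\<lambda>i. - Re (B $$ (i, i))) ` {..<n}))"
  have m: "m > 0" using neg unfolding m_def by (subst Min_gr_iff) auto
  have d: "m / 2 < - Re (B $$ (i, i))" if "i < n" for i
  proof -
    have "m \<le> - Re (B $$ (i, i))" unfolding m_def using that by (intro Min_le) auto
    then show ?thesis using m by linarith
  qed
  \<comment> \<open>From A = P B Q and Q P = 1; this intertwining turns X' = A X into an equation
    with matrix \<open>B\<close>.\<close>
  have QA: "Q * ?A = B * Q"
  proof -
    have "Q * (P * B * Q) = Q * (P * (B * Q))" using w by (simp add: assoc_mult_mat[of _ n n _ n _ n])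
    also have "\<dots> = Q * P * (B * Q)"
      by (rule assoc_mult_mat[symmetric, of _ n n _ n _ n]) (use w in auto)
    also have "\<dots> = B * Q" using w by simp
    finally show ?thesis using w(3) by simp
  qed
  \<comment> \<open>\<open>Y j\<close> is column \<open>j\<close> of Q e^(tA). Each column is a
    separate solution of the triangular system, hence the column index comes first.\<close>
  define Y where "Y j i t = (\<Sum>k<n. Q $$ (i, k) * ?X k j t)" for j i t
  have Y': "(Y j i has_vector_derivative (\<Sum>l<n. B $$ (i, l) * Y j l t)) (at t)"
    if i: "i < n" and j: "j < n" for i j t
  proof -
    have "((\<lambda>t. Q $$ (i, k) * ?X k j t) has_vector_derivative
        Q $$ (i, k) * (\<Sum>l<n. ?A $$ (k, l) * ?X l j t)) (at t)" if "k < n" for k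
    proof (rule has_vector_derivative_mult_right)
      have "(\<Sum>l<n. ?A $$ (k, l) * ?X l j t)
          = of_real (\<Sum>l<n. A $$ (k, l) * mat_exp (t \<cdot>\<^sub>m A) $$ (l, j))"
        using that A by simp
      then show "(?X k j has_vector_derivative (\<Sum>l<n. ?A $$ (k, l) * ?X l j t)) (at t)"
        using mat_exp_has_derivative[OF A that j, of t]
        by (simp only: has_vector_derivative_of_real has_real_derivative_iff_has_vector_derivative)
    qed
    then have "(Y j i has_vector_derivative
        (\<Sum>k<n. Q $$ (i, k) * (\<Sum>l<n. ?A $$ (k, l) * ?X l j t))) (at t)"
      unfolding Y_def by (intro has_vector_derivative_sum) auto
    also have "(\<Sum>k<n. Q $$ (i, k) * (\<Sum>l<n. ?A $$ (k, l) * ?X l j t))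
        = (\<Sum>l<n. \<Sum>k<n. Q $$ (i, k) * ?A $$ (k, l) * ?X l j t)"
      unfolding sum_distrib_left mult.assoc by (rule sum.swap)
    also have "\<dots> = (\<Sum>l<n. (Q * ?A) $$ (i, l) * ?X l j t)"
      by (intro sum.cong refl)
        (simp only: index_mult_mat_sum[OF w(7) cA i] lessThan_iff sum_distrib_right)
    also have "\<dots> = (\<Sum>l<n. \<Sum>k<n. B $$ (i, k) * Q $$ (k, l) * ?X l j t)"
      unfolding QA by (intro sum.cong refl)
        (simp only: index_mult_mat_sum[OF w(5,7) i] lessThan_iff sum_distrib_right)
    also have "\<dots> = (\<Sum>k<n. B $$ (i, k) * Y j k t)"
      unfolding Y_def sum_distrib_left mult.assoc by (rule sum.swap)
    finally show ?thesis .
  qed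
  \<comment> \<open>P Q = 1 recovers e^(tA) from its transformed columns, so decay carries back
    through a finite sum.\<close>
  have XY: "?X i j t = (\<Sum>k<n. P $$ (i, k) * Y j k t)" if i: "i < n" and j: "j < n" for i j t
  proof -
    have "(\<Sum>k<n. P $$ (i, k) * Y j k t) = (\<Sum>l<n. \<Sum>k<n. P $$ (i, k) * Q $$ (k, l) * ?X l j t)"
      unfolding Y_def sum_distrib_left mult.assoc by (rule sum.swap)
    also have "\<dots> = (\<Sum>l<n. (P * Q) $$ (i, l) * ?X l j t)"
      by (intro sum.cong refl)
        (simp only: index_mult_mat_sum[OF w(6,7) i] lessThan_iff sum_distrib_right)
    also have "\<dots> = (\<Sum>l<n. if i = l then ?X l j t else 0)"
      unfolding w(1) using i by (intro sum.cong) auto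
    also have "\<dots> = ?X i j t" using i by simp
    finally show ?thesis by simp
  qed
  have "\<exists>K. \<forall>t\<ge>0. \<bar>mat_exp (t \<cdot>\<^sub>m A) $$ (i, j)\<bar> \<le> K * exp (- (m / 2) * t)"
    if i: "i < n" and j: "j < n" for i j
  proof -
    have "\<exists>K. \<forall>t\<ge>0. norm (Y j k t) \<le> K * exp (- (m / 2) * t)" if "k < n" for k
      by (rule exponential_decay_triangular[OF w(5) ut Y'[OF _ j] d that])
    then obtain K where K: "\<And>k t. k < n \<Longrightarrow> t \<ge> 0 \<Longrightarrow> norm (Y j k t) \<le> K k * exp (- (m / 2) * t)"
      by metis
    have "norm (?X i j t) \<le> (\<Sum>k<n. norm (P $$ (i, k)) * K k) * exp (- (m / 2) * t)" if "t \<ge> 0" for t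
      unfolding XY[OF i j] sum_distrib_right
      by (rule sum_norm_le)
        (use K that in \<open>auto simp only: norm_mult mult.assoc lessThan_iff intro!: mult_left_mono norm_ge_zero\<close>)
    then show ?thesis by auto
  qed
  then show ?thesis using that[of "m / 2"] m by simp
qed

section \<open>Integrability on the half-line\<close>

lemma integrable_on_exponential_bound:
  fixes f :: "real \<Rightarrow> real"
  assumes "continuous_on UNIV f" and "d > 0"
    and "\<And>t. t \<ge> 0 \<Longrightarrow> \<bar>f t\<bar> \<le> K * exp (- d * t)"
  shows "f integrable_on {0..}"
proof (rule integrable_on_all_intervals_integrable_bound)
  \<comment> \<open>Continuity settles each bounded interval; the exponential majorant controls the
    tail.\<close>
  show "(\<lambda>t. if t \<in> {0..} then f t else 0) integrable_on cbox a b" for a b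
  proof -
    have "f integrable_on {0..} \<inter> cbox a b"
    proof -
      have "{0..} \<inter> cbox a b = {max 0 a..b}" by auto
      then show ?thesis
        using assms(1) by (auto intro!: integrable_continuous_real intro: continuous_on_subset)
    qed
    then show ?thesis by (simp only: integrable_restrict_Int)
  qed
  show "norm (f t) \<le> K * exp (- d * t)" if "t \<in> {0..}" for t using assms(3) that by simp
  show "(\<lambda>t. K * exp (- d * t)) integrable_on {0..}"
    using integrable_on_exp_minus_to_infinity[OF assms(2), of 0]
    by (rule integrable_on_mult_right)
qed

text \<open>The entries of the Gramian integrand are linear combinations of these products, and
  splitting the integral over the summands requires each to be integrable.\<close>

lemma mat_exp_product_integrable:
  assumes A: "A \<in> carrier_mat n n" and "stable_mat A" and "i < n" "k < n" "j < n" "l < n"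
  shows "(\<lambda>t. mat_exp (t \<cdot>\<^sub>m A) $$ (i, k) * mat_exp (t \<cdot>\<^sub>m A) $$ (j, l)) integrable_on {0..}"
proof -
  obtain d where d: "d > 0" and decay: "\<And>i j. i < n \<Longrightarrow> j < n \<Longrightarrow>
      \<exists>K. \<forall>t\<ge>0. \<bar>mat_exp (t \<cdot>\<^sub>m A) $$ (i, j)\<bar> \<le> K * exp (- d * t)"
    using mat_exp_exponential_decay[OF assms(1,2)] by blast
  obtain K L where
    K: "\<And>t. t \<ge> 0 \<Longrightarrow> \<bar>mat_exp (t \<cdot>\<^sub>m A) $$ (i, k)\<bar> \<le> K * exp (- d * t)" and
    L: "\<And>t. t \<ge> 0 \<Longrightarrow> \<bar>mat_exp (t \<cdot>\<^sub>m A) $$ (j, l)\<bar> \<le> L * exp (- d * t)"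
    using decay assms(3-6) by metis
  have cont: "continuous_on UNIV (\<lambda>t. mat_exp (t \<cdot>\<^sub>m A) $$ (i, j))" if "i < n" "j < n" for i j
    by (rule DERIV_continuous_on) (rule has_field_derivative_at_within[OF mat_exp_has_derivative[OF A that]])
  show ?thesis
  proof (rule integrable_on_exponential_bound)
    show "continuous_on UNIV (\<lambda>t. mat_exp (t \<cdot>\<^sub>m A) $$ (i, k) * mat_exp (t \<cdot>\<^sub>m A) $$ (j, l))"
      by (intro continuous_on_mult cont assms)
    show "\<bar>mat_exp (t \<cdot>\<^sub>m A) $$ (i, k) * mat_exp (t \<cdot>\<^sub>m A) $$ (j, l)\<bar> \<le> (K * L) * exp (- (2 * d) * t)"
      if "t \<ge> 0" for t
    proof -
      have "\<bar>mat_exp (t \<cdot>\<^sub>m A) $$ (i, k) * mat_exp (t \<cdot>\<^sub>m A) $$ (j, l)\<bar>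
          \<le> (K * exp (- d * t)) * (L * exp (- d * t))"
        unfolding abs_mult by (intro mult_mono K L that) (rule order_trans[OF abs_ge_zero K[OF that]], simp)
      also have "\<dots> = (K * L) * (exp (- d * t) * exp (- d * t))" by simp
      also have "\<dots> = (K * L) * exp (- (2 * d) * t)"
        unfolding exp_add[symmetric] by (simp add: algebra_simps)
      finally show ?thesis .
    qed
    show "2 * d > 0" using d by simp
  qed
qed

section \<open>Dependence of the Gramian on the input set\<close>

lemma input_mat_carrier: "input_mat B0 S \<in> carrier_mat (dim_row B0) (dim_col (input_mat B0 S))"
  by (rule carrier_matI) (simp_all add: input_mat_def)

text \<open>The product is the sum of the outer products of the columns, so the arbitrary listing
  chosen in \<open>input_mat\<close> disappears.\<close>

lemma input_mat_mult_transpose: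
  assumes "finite S" "B0 \<in> carrier_mat n m" "k < n" "l < n"
  shows "(input_mat B0 S * transpose_mat (input_mat B0 S)) $$ (k, l)
    = (\<Sum>c\<leftarrow>cols B0. c $ k * c $ l) + (\<Sum>s\<in>S. s $ k * s $ l)"
proof -
  define bs where "bs = (SOME bs. distinct bs \<and> set bs = S)"
  \<comment> \<open>Finiteness of \<open>S\<close> supplies a listing, so the chosen list really
    meets its specification.\<close>
  have bs: "distinct bs \<and> set bs = S"
    unfolding bs_def by (rule someI_ex) (use finite_distinct_list[OF assms(1)] in blast)
  have "(input_mat B0 S * transpose_mat (input_mat B0 S)) $$ (k, l)
      = (\<Sum>c\<leftarrow>cols B0 @ bs. c $ k * c $ l)"
    using assms unfolding input_mat_def bs_def[symmetric]
    by (simp add: scalar_prod_def mat_of_cols_index sum_list_sum_nth del: map_append)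
  also have "\<dots> = (\<Sum>c\<leftarrow>cols B0. c $ k * c $ l) + (\<Sum>s\<in>S. s $ k * s $ l)"
    using bs by (simp add: sum_list_distinct_conv_sum_set)
  finally show ?thesis .
qed

text \<open>This separates the variables: \<open>S\<close> enters only through the coefficients
  taken from B_S B_S^T, while the integrals depend on \<open>A\<close> alone.\<close>

lemma gramian_entry:
  assumes A: "A \<in> carrier_mat n n" and "stable_mat A" and B0: "B0 \<in> carrier_mat n m"
    and i: "i < n" and j: "j < n"
  shows "gramian A B0 S $$ (i, j) = (\<Sum>l<n. \<Sum>k<n.
    (input_mat B0 S * transpose_mat (input_mat B0 S)) $$ (k, l) *
    integral {0..} (\<lambda>t. mat_exp (t \<cdot>\<^sub>m A) $$ (i, k) * mat_exp (t \<cdot>\<^sub>m A) $$ (j, l)))"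
proof -
  let ?M = "input_mat B0 S" and ?E = "\<lambda>t. mat_exp (t \<cdot>\<^sub>m A)"
  have M: "?M \<in> carrier_mat n (dim_col ?M)" using input_mat_carrier[of B0 S] unfolding carrier_matD(1)[OF B0] .
  have E: "?E t \<in> carrier_mat n n" for t using A by simp
  have integrand: "(?E t * ?M * transpose_mat ?M * mat_exp (t \<cdot>\<^sub>m transpose_mat A)) $$ (i, j)
      = (\<Sum>l<n. \<Sum>k<n. (?M * transpose_mat ?M) $$ (k, l) * (?E t $$ (i, k) * ?E t $$ (j, l)))" for t
  proof -
    \<comment> \<open>The right-hand factor thereby contributes entry \<open>(j, l)\<close> of
      e^(tA) itself.\<close>
    have T: "mat_exp (t \<cdot>\<^sub>m transpose_mat A) = transpose_mat (?E t)"
    proof -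
      have "t \<cdot>\<^sub>m transpose_mat A = transpose_mat (t \<cdot>\<^sub>m A)" by (intro eq_matI) auto
      then show ?thesis using mat_exp_transpose[of "t \<cdot>\<^sub>m A" n] A by simp
    qed
    have "?E t * ?M * transpose_mat ?M = ?E t * (?M * transpose_mat ?M)"
      by (rule assoc_mult_mat[OF E M transpose_carrier_mat[THEN iffD2, OF M]])
    moreover have "(?E t * (?M * transpose_mat ?M) * transpose_mat (?E t)) $$ (i, j)
        = (\<Sum>l<n. \<Sum>k<n. ?E t $$ (i, k) * (?M * transpose_mat ?M) $$ (k, l) * transpose_mat (?E t) $$ (l, j))"
      by (rule index_mult_mat_sum3[OF E mult_carrier_mat[OF M] _ i j])
        (simp_all only: transpose_carrier_mat M E)
    moreover have "transpose_mat (?E t) $$ (l, j) = ?E t $$ (j, l)" if "l < n" for l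
      using that j E[of t] by simp
    ultimately have "(?E t * ?M * transpose_mat ?M * transpose_mat (?E t)) $$ (i, j)
        = (\<Sum>l<n. \<Sum>k<n. ?E t $$ (i, k) * (?M * transpose_mat ?M) $$ (k, l) * ?E t $$ (j, l))"
      by (simp only:) (intro sum.cong refl, simp only: lessThan_iff)
    also have "\<dots> = (\<Sum>l<n. \<Sum>k<n. (?M * transpose_mat ?M) $$ (k, l) * (?E t $$ (i, k) * ?E t $$ (j, l)))"
      by (intro sum.cong refl) (simp only: mult_ac)
    finally show ?thesis unfolding T .
  qed
  have "gramian A B0 S $$ (i, j) = integral {0..} (\<lambda>t. \<Sum>l<n. \<Sum>k<n.
      (?M * transpose_mat ?M) $$ (k, l) * (?E t $$ (i, k) * ?E t $$ (j, l)))"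
    using A i j integrand by (simp add: gramian_def del: index_mult_mat(1))
  also have "\<dots> = (\<Sum>l<n. integral {0..} (\<lambda>t. \<Sum>k<n.
      (?M * transpose_mat ?M) $$ (k, l) * (?E t $$ (i, k) * ?E t $$ (j, l))))"
    by (intro integral_sum integrable_sum integrable_on_mult_right
        mat_exp_product_integrable[OF assms(1,2)] i j) auto
  also have "\<dots> = (\<Sum>l<n. \<Sum>k<n. integral {0..} (\<lambda>t.
      (?M * transpose_mat ?M) $$ (k, l) * (?E t $$ (i, k) * ?E t $$ (j, l))))"
    by (intro sum.cong refl integral_sum integrable_on_mult_right
        mat_exp_product_integrable[OF assms(1,2)] i j) auto
  finally show ?thesis by simp
qed

text \<open>The contribution of \<open>B0\<close> occurs twice on each side, and the sums over
  elements match by inclusion-exclusion.\<close>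

lemma input_mat_mult_transpose_modular:
  assumes "finite X" "finite Y" "B0 \<in> carrier_mat n m" "k < n" "l < n"
  shows "(input_mat B0 X * transpose_mat (input_mat B0 X)) $$ (k, l)
      + (input_mat B0 Y * transpose_mat (input_mat B0 Y)) $$ (k, l)
    = (input_mat B0 (X \<union> Y) * transpose_mat (input_mat B0 (X \<union> Y))) $$ (k, l)
      + (input_mat B0 (X \<inter> Y) * transpose_mat (input_mat B0 (X \<inter> Y))) $$ (k, l)"
  using assms sum.union_inter[OF assms(1,2), of "\<lambda>s. s $ k * s $ l"]
  by (simp add: input_mat_mult_transpose[of _ _ n m] del: index_mult_mat(1))

text \<open>The identity for B_S B_S^T passes through the fixed linear combination of integrals in
  \<open>gramian_entry\<close>.\<close>

lemma gramian_modular: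
  assumes "A \<in> carrier_mat n n" "stable_mat A" "B0 \<in> carrier_mat n m"
    and "finite X" "finite Y" "i < n" "j < n"
  shows "gramian A B0 X $$ (i, j) + gramian A B0 Y $$ (i, j)
    = gramian A B0 (X \<union> Y) $$ (i, j) + gramian A B0 (X \<inter> Y) $$ (i, j)"
  unfolding gramian_entry[OF assms(1-3,6,7)] sum.distrib[symmetric] distrib_right[symmetric]
  by (intro sum.cong refl arg_cong2[of _ _ _ _ "(*)"] input_mat_mult_transpose_modular[OF assms(4,5,3)])
    auto

theorem theorem4:
  fixes A B0 C :: "real mat" and V :: "real vec set" and n m p :: nat
  assumes "A \<in> carrier_mat n n"
    and "stable_mat A"
    and "finite V" and "V \<subseteq> carrier_vec n"
    and "B0 \<in> carrier_mat n m"
    and "C \<in> carrier_mat p n"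
  shows "modular_on V (\<lambda>S. mat_trace (C * gramian A B0 S * transpose_mat C))"
proof -
  \<comment> \<open>The trace is a linear combination of Gramian entries whose weights do not
    involve \<open>S\<close>, so it inherits their modularity.\<close>
  have tr: "mat_trace (C * gramian A B0 S * transpose_mat C)
      = (\<Sum>a<p. \<Sum>j<n. \<Sum>i<n. gramian A B0 S $$ (i, j) * (C $$ (a, i) * C $$ (a, j)))" for S
  proof -
    have G: "gramian A B0 S \<in> carrier_mat n n" using assms(1) by (simp add: gramian_def)
    have "(C * gramian A B0 S * transpose_mat C) $$ (a, a)
        = (\<Sum>j<n. \<Sum>i<n. C $$ (a, i) * gramian A B0 S $$ (i, j) * transpose_mat C $$ (j, a))"
      if "a < p" for a
      by (rule index_mult_mat_sum3[OF assms(6) G _ that that]) (use assms(6) in simp)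
    then show ?thesis
      using assms(6) by (simp add: mat_trace_def mult_ac del: index_mult_mat(1))
  qed
  have "mat_trace (C * gramian A B0 X * transpose_mat C) + mat_trace (C * gramian A B0 Y * transpose_mat C)
      = mat_trace (C * gramian A B0 (X \<union> Y) * transpose_mat C)
        + mat_trace (C * gramian A B0 (X \<inter> Y) * transpose_mat C)"
    if "X \<subseteq> V" "Y \<subseteq> V" for X Y
  proof -
    have fin: "finite X" "finite Y" using that assms(3) by (auto intro: finite_subset)
    show ?thesis
      unfolding tr sum.distrib[symmetric] distrib_right[symmetric]
      by (intro sum.cong refl arg_cong2[of _ _ _ _ "(*)"] gramian_modular[OF assms(1,2,5) fin]) auto
  qed
  \<comment> \<open>The equality yields both the submodular and the supermodular inequality.\<close>
  then show ?thesis
    unfolding modular_on_def submodular_on_def supermodular_on_def by (simp add: add_ac)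
qed

end
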